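(* Let $\Gamma_1>\Gamma_2>0$ and $C\in\mathbb R$, and put $q=e^{-\pi/2}$. Let the reduced Hamiltonian $\mathcal H(X,y_1)$, for $X=x_1-x_2\in[-\pi,\pi]$ and $y_1\in\mathbb R$, be obtained by substituting $y_2=\frac{C-\Gamma_1y_1}{\Gamma_2}$ into $$\mathcal H=-\frac{\Gamma_1\Gamma_2}{2\pi}\log\Big|\theta_1\Big(\frac{X+i(y_1-y_2)}2,q\Big)\Big|+\frac{\Gamma_1\Gamma_2}{2\pi}\log\Big|\theta_2\Big(\frac{X+i(y_1+y_2)}2,q\Big)\Big|-\frac{\Gamma_1\Gamma_2}{\pi^2}y_1y_2$$ $$\qquad+\frac{\Gamma_1^2}{4\pi}\Big(\log\Big|\theta_1\Big(iy_1-\frac\pi2,q\Big)\Big|-\frac{2y_1^2}\pi\Big)+\frac{\Gamma_2^2}{4\pi}\Big(\log\Big|\theta_1\Big(iy_2-\frac\pi2,q\Big)\Big|-\frac{2y_2^2}\pi\Big).$$ Then the only singular points of the reduced Hamiltonian on the line $X=0$ are the points $y_1=\frac{\pi k\Gamma_2+C}{\Gamma_1+\Gamma_2}$, $k\in\mathbb Z$, and the only singular points on the lines $X=\pm\pi$ are the points $y_1=\frac{k\pi\Gamma_2-C}{\Gamma_2-\Gamma_1}$, $k\in\mathbb Z$.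
   Context: $\theta_1(z,q)=2\sum_{n\ge0}(-1)^nq^{(n+1/2)^2}\sin((2n+1)z)$ and $\theta_2(z,q)=2\sum_{n\ge0}q^{(n+1/2)^2}\cos((2n+1)z)$ are Jacobi theta functions. $\mathcal H$ is the Hamiltonian of two point vortices with strengths $\Gamma_1,\Gamma_2$ at $x_j+iy_j$ on the Klein bottle, and $C=\Gamma_1y_1+\Gamma_2y_2$ is its constant of motion. A singular point is a point at which $\mathcal H$ is infinite, i.e. one of the logarithms has argument $0$. *)

theory Defs
  imports "HOL-Analysis.Analysis"
begin

text \<open>For a nome 0 < q < 1 both theta series converge absolutely for every complex z.\<close>

definition theta1 :: "complex \<Rightarrow> real \<Rightarrow> complex" where
  "theta1 z q = 2 * (\<Sum>n. (-1) ^ n * of_real (q powr ((real n + 1/2)\<^sup>2)) * sin (of_nat (2 * n + 1) * z))"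

definition theta2 :: "complex \<Rightarrow> real \<Rightarrow> complex" where
  "theta2 z q = 2 * (\<Sum>n. of_real (q powr ((real n + 1/2)\<^sup>2)) * cos (of_nat (2 * n + 1) * z))"

text \<open>
  The library logarithm satisfies \<open>ln 0 = 0\<close>. The Hamiltonian has to become infinite where the
  argument of a logarithm vanishes, so it is built from the logarithm of the modulus as an
  extended real number, with value \<open>-\<infinity>\<close> at 0.
\<close>

definition log_abs :: "complex \<Rightarrow> ereal" where
  "log_abs w = (if w = 0 then -\<infinity> else ereal (ln (norm w)))"

definition hamiltonian :: "real \<Rightarrow> real \<Rightarrow> real \<Rightarrow> real \<Rightarrow> real \<Rightarrow> real \<Rightarrow> ereal" where
  "hamiltonian q \<Gamma>\<^sub>1 \<Gamma>\<^sub>2 X y\<^sub>1 y\<^sub>2 =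
     - ereal (\<Gamma>\<^sub>1 * \<Gamma>\<^sub>2 / (2 * pi)) * log_abs (theta1 ((of_real X + \<i> * of_real (y\<^sub>1 - y\<^sub>2)) / 2) q)
     + ereal (\<Gamma>\<^sub>1 * \<Gamma>\<^sub>2 / (2 * pi)) * log_abs (theta2 ((of_real X + \<i> * of_real (y\<^sub>1 + y\<^sub>2)) / 2) q)
     - ereal (\<Gamma>\<^sub>1 * \<Gamma>\<^sub>2 / pi\<^sup>2 * y\<^sub>1 * y\<^sub>2)
     + ereal (\<Gamma>\<^sub>1\<^sup>2 / (4 * pi)) * (log_abs (theta1 (\<i> * of_real y\<^sub>1 - of_real pi / 2) q) - ereal (2 * y\<^sub>1\<^sup>2 / pi))
     + ereal (\<Gamma>\<^sub>2\<^sup>2 / (4 * pi)) * (log_abs (theta1 (\<i> * of_real y\<^sub>2 - of_real pi / 2) q) - ereal (2 * y\<^sub>2\<^sup>2 / pi))"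

definition reduced_hamiltonian :: "real \<Rightarrow> real \<Rightarrow> real \<Rightarrow> real \<Rightarrow> real \<Rightarrow> real \<Rightarrow> ereal" where
  "reduced_hamiltonian q \<Gamma>\<^sub>1 \<Gamma>\<^sub>2 C X y\<^sub>1 = hamiltonian q \<Gamma>\<^sub>1 \<Gamma>\<^sub>2 X y\<^sub>1 ((C - \<Gamma>\<^sub>1 * y\<^sub>1) / \<Gamma>\<^sub>2)"

definition singular_points :: "(real \<Rightarrow> real \<Rightarrow> ereal) \<Rightarrow> (real \<times> real) set" where
  "singular_points H = {(X, y). X \<in> {-pi..pi} \<and> \<bar>H X y\<bar> = \<infinity>}"

text \<open>
  A sum of extended reals is infinite as soon as one summand is (in this library
  \<open>\<infinity> + (-\<infinity>) = \<infinity>\<close>), so no singularity is lost by cancellation: the Hamiltonian is infinite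
  exactly where the argument of one of its logarithms is 0, and elsewhere it is given by the
  real formula.
\<close>

lemma hamiltonian_infinite_iff:
  assumes "\<Gamma>\<^sub>1 \<noteq> 0" "\<Gamma>\<^sub>2 \<noteq> 0"
  shows "\<bar>hamiltonian q \<Gamma>\<^sub>1 \<Gamma>\<^sub>2 X y\<^sub>1 y\<^sub>2\<bar> = \<infinity> \<longleftrightarrow>
     theta1 ((of_real X + \<i> * of_real (y\<^sub>1 - y\<^sub>2)) / 2) q = 0 \<or>
     theta2 ((of_real X + \<i> * of_real (y\<^sub>1 + y\<^sub>2)) / 2) q = 0 \<or>
     theta1 (\<i> * of_real y\<^sub>1 - of_real pi / 2) q = 0 \<or>
     theta1 (\<i> * of_real y\<^sub>2 - of_real pi / 2) q = 0"
proof -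
  have log: "\<bar>log_abs w\<bar> = \<infinity> \<longleftrightarrow> w = 0" for w
    by (simp add: log_abs_def)
  have add: "\<bar>a + b\<bar> = \<infinity> \<longleftrightarrow> \<bar>a\<bar> = \<infinity> \<or> \<bar>b\<bar> = \<infinity>" for a b :: ereal
    by (cases a; cases b) auto
  have diff: "\<bar>a - ereal r\<bar> = \<infinity> \<longleftrightarrow> \<bar>a\<bar> = \<infinity>" for a r
    by (cases a) auto
  have mult: "\<bar>ereal r * a\<bar> = \<infinity> \<longleftrightarrow> \<bar>a\<bar> = \<infinity>" if "r \<noteq> 0" for a r
    using that by (cases a) auto
  have "\<Gamma>\<^sub>1 * \<Gamma>\<^sub>2 / (2 * pi) \<noteq> 0" "- (\<Gamma>\<^sub>1 * \<Gamma>\<^sub>2 / (2 * pi)) \<noteq> 0"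
    "\<Gamma>\<^sub>1\<^sup>2 / (4 * pi) \<noteq> 0" "\<Gamma>\<^sub>2\<^sup>2 / (4 * pi) \<noteq> 0"
    using assms by auto
  note m = this[THEN mult]
  show ?thesis
    unfolding hamiltonian_def uminus_ereal.simps(1) add diff m log by blast
qed

lemma hamiltonian_finite:
  assumes "theta1 ((of_real X + \<i> * of_real (y\<^sub>1 - y\<^sub>2)) / 2) q \<noteq> 0"
    and "theta2 ((of_real X + \<i> * of_real (y\<^sub>1 + y\<^sub>2)) / 2) q \<noteq> 0"
    and "theta1 (\<i> * of_real y\<^sub>1 - of_real pi / 2) q \<noteq> 0"
    and "theta1 (\<i> * of_real y\<^sub>2 - of_real pi / 2) q \<noteq> 0"
  shows "hamiltonian q \<Gamma>\<^sub>1 \<Gamma>\<^sub>2 X y\<^sub>1 y\<^sub>2 = ereal (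
     - \<Gamma>\<^sub>1 * \<Gamma>\<^sub>2 / (2 * pi) * ln (norm (theta1 ((of_real X + \<i> * of_real (y\<^sub>1 - y\<^sub>2)) / 2) q))
     + \<Gamma>\<^sub>1 * \<Gamma>\<^sub>2 / (2 * pi) * ln (norm (theta2 ((of_real X + \<i> * of_real (y\<^sub>1 + y\<^sub>2)) / 2) q))
     - \<Gamma>\<^sub>1 * \<Gamma>\<^sub>2 / pi\<^sup>2 * y\<^sub>1 * y\<^sub>2
     + \<Gamma>\<^sub>1\<^sup>2 / (4 * pi) * (ln (norm (theta1 (\<i> * of_real y\<^sub>1 - of_real pi / 2) q)) - 2 * y\<^sub>1\<^sup>2 / pi)
     + \<Gamma>\<^sub>2\<^sup>2 / (4 * pi) * (ln (norm (theta1 (\<i> * of_real y\<^sub>2 - of_real pi / 2) q)) - 2 * y\<^sub>2\<^sup>2 / pi))"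
  using assms by (simp add: hamiltonian_def log_abs_def)

end

theory Submission
  imports Defs
begin

text \<open>
  On the four lines in question the theta functions reduce, up to a unit factor, to real series:
  either \<open>\<Sum>n. q^((n+1/2)^2) * cosh ((2n+1) t)\<close>, which is positive, or
  \<open>S t = (\<Sum>n. (-1)^n * q^((n+1/2)^2) * sinh ((2n+1) t))\<close>. The function \<open>S\<close> is odd and
  satisfies \<open>S (t - ln q) = - exp (2 t) / q * S t\<close>, so its zeros are determined by those with
  \<open>0 \<le> t \<le> - ln q / 2\<close>. If \<open>q < 1/3\<close>, the terms of the series are strictly decreasing in
  modulus there, so it is alternating and positive for \<open>t > 0\<close>. Hence \<open>S\<close> vanishes exactly at the
  integer multiples of \<open>ln q\<close>, and \<open>ln q = - pi / 2\<close> for the given nome.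
\<close>

section \<open>Nome coefficients and convergence of the series\<close>

abbreviation nome_coeff :: "real \<Rightarrow> nat \<Rightarrow> real" where
  "nome_coeff q n \<equiv> q powr ((real n + 1/2)\<^sup>2)"

text \<open>Consecutive exponents differ by 2n+2. This one recurrence drives the convergence, the
  quasi-periodicity and the monotonicity below.\<close>

lemma nome_coeff_Suc:
  assumes "q > 0"
  shows "nome_coeff q (Suc n) = q ^ (2 * n + 2) * nome_coeff q n"
proof -
  have "(real (Suc n) + 1/2)\<^sup>2 = real (2 * n + 2) + (real n + 1/2)\<^sup>2"
    by (simp add: power2_eq_square algebra_simps)
  then show ?thesis
    using assms by (simp only: powr_add powr_realpow)
qed

text \<open>Consecutive terms have ratio \<open>q ^ (2 * n + 2) * exp (2 * t)\<close>, which tends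
  to 0, so it is eventually at most 1/2. Since t may have either sign, the hyperbolic series follow
  by linear combination.\<close>

lemma summable_nome_exp:
  assumes "0 < q" "q < 1"
  shows "summable (\<lambda>n. nome_coeff q n * exp (real (2 * n + 1) * t))"
proof -
  have "(\<lambda>n. q ^ n) \<longlonglongrightarrow> 0"
    using assms by (simp add: LIMSEQ_realpow_zero)
  then have "\<forall>\<^sub>F n in sequentially. q ^ n < exp (- (2 * t)) / 2"
    by (rule order_tendstoD) simp
  then obtain N where N: "q ^ n < exp (- (2 * t)) / 2" if "n \<ge> N" for n
    by (auto simp: eventually_sequentially)
  show ?thesis
  proof (rule summable_ratio_test[of "1/2" N])
    fix n assume "n \<ge> N"
    have "q ^ (2 * n + 2) \<le> q ^ n"
      using assms by (intro power_decreasing) auto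
    also have "\<dots> \<le> exp (- (2 * t)) / 2"
      using N[OF \<open>n \<ge> N\<close>] by simp
    finally have "q ^ (2 * n + 2) * exp (2 * t) \<le> 1 / 2"
      by (simp add: exp_minus field_simps)
    moreover have "exp (real (2 * Suc n + 1) * t) = exp (2 * t) * exp (real (2 * n + 1) * t)"
      by (simp add: algebra_simps flip: exp_add)
    then have "nome_coeff q (Suc n) * exp (real (2 * Suc n + 1) * t) =
      (q ^ (2 * n + 2) * exp (2 * t)) * (nome_coeff q n * exp (real (2 * n + 1) * t))"
      by (simp only: nome_coeff_Suc[OF assms(1)] mult_ac)
    ultimately show "norm (nome_coeff q (Suc n) * exp (real (2 * Suc n + 1) * t))
      \<le> 1/2 * norm (nome_coeff q n * exp (real (2 * n + 1) * t))"
      using assms by (simp add: abs_mult mult_right_mono)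
  qed simp
qed

lemma summable_alternating_nome_exp:
  assumes "0 < q" "q < 1"
  shows "summable (\<lambda>n. (-1) ^ n * nome_coeff q n * exp (real (2 * n + 1) * t))"
proof (rule summable_norm_cancel)
  show "summable (\<lambda>n. norm ((-1) ^ n * nome_coeff q n * exp (real (2 * n + 1) * t)))"
    using summable_nome_exp[OF assms, of t] by (simp add: abs_mult power_abs)
qed

lemma summable_nome_cosh:
  assumes "0 < q" "q < 1"
  shows "summable (\<lambda>n. nome_coeff q n * cosh (real (2 * n + 1) * t))"
  using summable_mult[OF summable_add[OF summable_nome_exp[OF assms, of t]
    summable_nome_exp[OF assms, of "-t"]], of "1/2"]
  by (simp add: cosh_def algebra_simps)

section \<open>The sinh series and its quasi-periodicity\<close>

definition sinh_theta :: "real \<Rightarrow> real \<Rightarrow> real" where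
  "sinh_theta q t = (\<Sum>n. (-1) ^ n * nome_coeff q n * sinh (real (2 * n + 1) * t))"

text \<open>The exponential half of \<open>sinh_theta\<close>. A shift of t by \<open>ln q\<close>
  turns each exponential into a multiple of itself, which fails for sinh because its two
  exponentials scale in opposite ways.\<close>

definition exp_theta :: "real \<Rightarrow> real \<Rightarrow> real" where
  "exp_theta q t = (\<Sum>n. (-1) ^ n * nome_coeff q n * exp (real (2 * n + 1) * t))"

lemma sums_exp_theta:
  assumes "0 < q" "q < 1"
  shows "(\<lambda>n. (-1) ^ n * nome_coeff q n * exp (real (2 * n + 1) * t)) sums exp_theta q t"
  unfolding exp_theta_def using summable_alternating_nome_exp[OF assms] by (rule summable_sums)

lemma sums_sinh_exp_theta:
  assumes "0 < q" "q < 1"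
  shows "(\<lambda>n. (-1) ^ n * nome_coeff q n * sinh (real (2 * n + 1) * t)) sums
    ((exp_theta q t - exp_theta q (-t)) / 2)"
  using sums_divide[OF sums_diff[OF sums_exp_theta[OF assms, of t]
    sums_exp_theta[OF assms, of "-t"]], of 2]
  by (simp add: sinh_def algebra_simps diff_divide_distrib)

lemma sinh_theta_eq_exp_theta:
  assumes "0 < q" "q < 1"
  shows "sinh_theta q t = (exp_theta q t - exp_theta q (-t)) / 2"
  unfolding sinh_theta_def using sums_sinh_exp_theta[OF assms] by (rule sums_unique[symmetric])

lemma sums_sinh_theta:
  assumes "0 < q" "q < 1"
  shows "(\<lambda>n. (-1) ^ n * nome_coeff q n * sinh (real (2 * n + 1) * t)) sums sinh_theta q t"
  using sums_sinh_exp_theta[OF assms] by (simp only: sinh_theta_eq_exp_theta[OF assms])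

lemma sinh_theta_0 [simp]: "sinh_theta q 0 = 0"
  by (simp add: sinh_theta_def)

lemma sinh_theta_minus [simp]:
  assumes "0 < q" "q < 1"
  shows "sinh_theta q (-t) = - sinh_theta q t"
  by (simp add: sinh_theta_eq_exp_theta[OF assms] field_simps)

text \<open>The shift multiplies the n-th term by q^(2n+1), and by the recurrence this turns the
  coefficient of index n into that of index n+1 divided by q. The series is thus moved by one index
  with a change of sign; as it is one-sided, its term of index 0 is left over.\<close>

lemma exp_theta_add_ln:
  assumes "0 < q" "q < 1"
  shows "exp_theta q (t + ln q) = (nome_coeff q 0 * exp t - exp_theta q t) / (q * exp (2 * t))"
proof -
  define f where "f n = (-1) ^ n * nome_coeff q n * exp (real (2 * n + 1) * t)" for n
  have f: "f sums exp_theta q t"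
    unfolding f_def by (rule sums_exp_theta[OF assms])
  have "exp (real (2 * n + 1) * (t + ln q)) = exp (real (2 * n + 1) * t) * q ^ (2 * n + 1)" for n
    using assms(1)
    by (simp only: distrib_left exp_add powr_realpow[symmetric] powr_def) auto
  moreover have "exp (real (2 * Suc n + 1) * t) = exp (2 * t) * exp (real (2 * n + 1) * t)" for n
    by (simp add: algebra_simps flip: exp_add)
  ultimately have "(-1) ^ n * nome_coeff q n * exp (real (2 * n + 1) * (t + ln q)) =
      - f (Suc n) / (q * exp (2 * t))" for n
    using assms(1) unfolding f_def by (simp only: nome_coeff_Suc) simp
  then have "exp_theta q (t + ln q) = (\<Sum>n. - f (Suc n) / (q * exp (2 * t)))"
    unfolding exp_theta_def by presburger
  moreover have "(\<lambda>n. f (Suc n)) sums (exp_theta q t - f 0)"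
    using f by (simp add: sums_Suc_iff)
  then have "(\<lambda>n. - f (Suc n) / (q * exp (2 * t))) sums
      (- (exp_theta q t - f 0) / (q * exp (2 * t)))"
    by (intro sums_divide sums_minus)
  ultimately show ?thesis
    by (simp add: sums_iff f_def)
qed

text \<open>The leftover terms of the two exponential halves coincide and cancel in their
  difference.\<close>

lemma sinh_theta_diff_ln:
  assumes "0 < q" "q < 1"
  shows "sinh_theta q (t - ln q) = - exp (2 * t) / q * sinh_theta q t"
proof -
  \<comment> \<open>The half at t is shifted by \<open>- ln q\<close>, so the shift formula is
    applied at \<open>t - ln q\<close> and solved for its right-hand side.\<close>
  have "exp_theta q t = (nome_coeff q 0 * (exp t / q) - exp_theta q (t - ln q)) * q / exp (2 * t)"
    using exp_theta_add_ln[OF assms, of "t - ln q"] assms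
    by (simp add: exp_diff right_diff_distrib exp_double power2_eq_square)
  then have "exp (2 * t) * exp_theta q t =
      (nome_coeff q 0 * (exp t / q) - exp_theta q (t - ln q)) * q"
    by (simp add: mult.commute)
  also have "\<dots> = nome_coeff q 0 * exp t - q * exp_theta q (t - ln q)"
    using assms by (simp add: left_diff_distrib)
  finally have "exp (2 * t) * exp_theta q t = nome_coeff q 0 * exp t - q * exp_theta q (t - ln q)" .
  then have "exp_theta q (t - ln q) = (nome_coeff q 0 * exp t - exp (2 * t) * exp_theta q t) / q"
    using assms by (simp add: field_simps)
  \<comment> \<open>The other half moves in the opposite direction, so the shift formula applies
    directly at \<open>-t\<close>.\<close>
  moreover have "exp_theta q (- (t - ln q)) =
      (nome_coeff q 0 * exp t - exp (2 * t) * exp_theta q (-t)) / q"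
  proof -
    have "exp_theta q (- (t - ln q)) =
        (nome_coeff q 0 * exp (-t) - exp_theta q (-t)) / (q * exp (2 * (-t)))"
      using exp_theta_add_ln[OF assms, of "-t"] by simp
    also have "\<dots> = (nome_coeff q 0 * (exp (2 * t) * exp (-t)) - exp (2 * t) * exp_theta q (-t)) / q"
      by (simp add: exp_minus field_simps)
    also have "exp (2 * t) * exp (-t) = exp t"
      by (simp flip: exp_add)
    finally show ?thesis .
  qed
  ultimately show ?thesis
    unfolding sinh_theta_eq_exp_theta[OF assms] using assms by (simp add: field_simps)
qed

lemma sinh_theta_shift_int_eq_0_iff:
  assumes "0 < q" "q < 1"
  shows "sinh_theta q (t + of_int k * ln q) = 0 \<longleftrightarrow> sinh_theta q t = 0"
proof (induction k rule: int_induct[of _ 0])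
  case base
  then show ?case by simp
next
  case (step1 i)
  have "sinh_theta q (t + of_int i * ln q) = 0 \<longleftrightarrow>
      sinh_theta q (t + of_int (i + 1) * ln q) = 0"
    using sinh_theta_diff_ln[OF assms, of "t + of_int (i + 1) * ln q"] assms
    by (simp add: algebra_simps)
  with step1 show ?case by simp
next
  case (step2 i)
  have "sinh_theta q (t + of_int (i - 1) * ln q) = 0 \<longleftrightarrow>
      sinh_theta q (t + of_int i * ln q) = 0"
    using sinh_theta_diff_ln[OF assms, of "t + of_int i * ln q"] assms
    by (simp add: algebra_simps)
  with step2 show ?case by simp
qed

section \<open>Positivity on half a period and the zeros of the sinh series\<close>

lemma sinh_add_double_le:
  fixes a t :: real
  assumes "t \<le> a"
  shows "sinh (a + 2 * t) \<le> (2 * cosh (2 * t) + 1) * sinh a"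
proof -
  \<comment> \<open>The product with cosh expands to sinh(a+2t) + sinh(a-2t); what remains is
    sinh(a-2t) + sinh a. The bound is sharp at a = t, where it is the triple-argument formula for
    sinh.\<close>
  have "(2 * cosh (2 * t) + 1) * sinh a - sinh (a + 2 * t) = 2 * cosh t * sinh (a - t)"
    unfolding sinh_add sinh_diff sinh_double cosh_double_cosh
    by (simp add: algebra_simps power2_eq_square)
  moreover have "\<dots> \<ge> 0"
    using assms by simp
  ultimately show ?thesis by linarith
qed

lemma sinh_theta_pos:
  assumes "0 < q" "q < 1/3" "0 < t" "t \<le> - ln q / 2"
  shows "sinh_theta q t > 0"
proof -
  define a where "a n = nome_coeff q n * sinh (real (2 * n + 1) * t)" for n
  have a_pos: "a n > 0" for n
    using assms by (simp add: a_def)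
  have "2 * t \<le> ln (1 / q)"
    using assms by (simp add: ln_div)
  then have "exp (2 * t) \<le> exp (ln (1 / q))"
    by simp
  then have exp_le: "exp (2 * t) \<le> 1 / q"
    using assms by simp
  have "exp (- (2 * t)) \<le> 1" "1 \<le> exp (2 * t)"
    using assms by auto
  then have "exp (2 * t) + exp (- (2 * t)) + 1 \<le> 3 * exp (2 * t)"
    by linarith
  then have "2 * cosh (2 * t) + 1 \<le> 3 * exp (2 * t)"
    by (simp add: cosh_field_def field_simps)
  with exp_le have cosh_le: "2 * cosh (2 * t) + 1 \<le> 3 / q"
    by simp
  have a_dec: "a (Suc n) < a n" for n
  proof -
    \<comment> \<open>The ratio of consecutive terms is at most q^2 * 3/q = 3q, uniformly in n; this
      is where q < 1/3 enters.\<close>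
    have "q ^ (2 * n + 2) * (2 * cosh (2 * t) + 1) \<le> q ^ 2 * (3 / q)"
      using assms cosh_le cosh_real_pos[of "2 * t"]
      by (intro mult_mono power_decreasing) auto
    also have "\<dots> < 1"
      using assms by (simp add: power2_eq_square)
    finally have ratio: "q ^ (2 * n + 2) * (2 * cosh (2 * t) + 1) < 1" .
    have "sinh (real (2 * Suc n + 1) * t) \<le> (2 * cosh (2 * t) + 1) * sinh (real (2 * n + 1) * t)"
      using sinh_add_double_le[of t "real (2 * n + 1) * t"] assms
      by (simp add: algebra_simps)
    then have "a (Suc n) \<le> nome_coeff q (Suc n) * ((2 * cosh (2 * t) + 1) * sinh (real (2 * n + 1) * t))"
      unfolding a_def by (intro mult_left_mono) auto
    also have "\<dots> = q ^ (2 * n + 2) * (2 * cosh (2 * t) + 1) * a n"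
      by (simp only: a_def nome_coeff_Suc[OF assms(1)] mult_ac)
    also have "\<dots> < a n"
      using mult_strict_right_mono[OF ratio a_pos] by simp
    finally show ?thesis .
  qed
  have "q < 1" using assms by simp
  have "summable (\<lambda>n. nome_coeff q n * exp (real (2 * n + 1) * t) -
      nome_coeff q n * exp (real (2 * n + 1) * - t))"
    using assms \<open>q < 1\<close> by (intro summable_diff summable_nome_exp)
  then have "summable (\<lambda>n. 1/2 * (nome_coeff q n * exp (real (2 * n + 1) * t) -
      nome_coeff q n * exp (real (2 * n + 1) * - t)))"
    by (rule summable_mult)
  then have "summable a"
    by (simp add: a_def[abs_def] sinh_def algebra_simps)
  then have "a \<longlonglongrightarrow> 0"
    by (rule summable_LIMSEQ_zero)
  \<comment> \<open>Even partial sums of an alternating series are lower bounds for its sum. The one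
    with two terms, \<open>a 0 - a 1\<close>, is already positive.\<close>
  then have "(\<Sum>n<2 * 1. (-1) ^ n * a n) \<le> (\<Sum>n. (-1) ^ n * a n)"
    using a_pos a_dec by (intro summable_Leibniz'(2)) (auto intro: less_imp_le)
  also have "\<dots> = sinh_theta q t"
    by (simp add: sinh_theta_def a_def mult.assoc)
  finally show ?thesis
    using a_dec[of 0] by (simp add: numeral_2_eq_2)
qed

lemma sinh_theta_eq_0_iff:
  assumes "0 < q" "q < 1/3"
  shows "sinh_theta q t = 0 \<longleftrightarrow> (\<exists>k::int. t = of_int k * ln q)"
proof
  have "q < 1" using assms by simp
  note q = assms(1) \<open>q < 1\<close>
  show "sinh_theta q t = 0" if "\<exists>k::int. t = of_int k * ln q"
    using that sinh_theta_shift_int_eq_0_iff[OF q, of 0] by auto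
  assume zero: "sinh_theta q t = 0"
  \<comment> \<open>Rounding to the nearest multiple of \<open>ln q\<close> leaves a remainder of
    modulus at most half a period. Positivity then applies to u or, by oddness, to -u, unless u =
    0.\<close>
  define k where "k = round (t / ln q)"
  define u where "u = t - of_int k * ln q"
  have "ln q < 0" using q by simp
  have "\<bar>t / ln q - of_int k\<bar> \<le> 1 / 2"
    unfolding k_def using of_int_round_abs_le[of "t / ln q"] by (simp add: abs_minus_commute)
  then have "\<bar>u / ln q\<bar> \<le> 1 / 2"
    using \<open>ln q < 0\<close> by (simp add: u_def diff_divide_distrib)
  then have u_le: "\<bar>u\<bar> \<le> - ln q / 2"
    using \<open>ln q < 0\<close> by (simp add: abs_divide field_simps)
  have "sinh_theta q u = 0"
    using sinh_theta_shift_int_eq_0_iff[OF q, of u k] zero by (simp add: u_def)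
  then have "u = 0"
    using sinh_theta_pos[OF assms, of u] sinh_theta_pos[OF assms, of "-u"] u_le q
    by (cases u "0::real" rule: linorder_cases) auto
  then show "\<exists>k::int. t = of_int k * ln q"
    by (auto simp: u_def)
qed

section \<open>Theta functions on the imaginary axis and its translates by half of pi\<close>

lemma sin_i_times_of_real: "sin (\<i> * of_real x) = \<i> * of_real (sinh x)"
  by (simp add: sin_i_times sinh_field_def exp_minus exp_of_real)

lemma cos_i_times_of_real: "cos (\<i> * of_real x) = of_real (cosh x)"
  by (simp add: cos_i_times cosh_field_def exp_minus exp_of_real)

lemma sin_odd_times_i:
  "sin (of_nat (2 * n + 1) * (\<i> * of_real t)) = \<i> * of_real (sinh (real (2 * n + 1) * t))"
proof -
  have "sin (of_nat (2 * n + 1) * (\<i> * of_real t)) =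
      sin (\<i> * of_real (real (2 * n + 1) * t))"
    by (simp add: algebra_simps)
  then show ?thesis
    by (simp only: sin_i_times_of_real)
qed

lemma cos_odd_times_i:
  "cos (of_nat (2 * n + 1) * (\<i> * of_real t)) = of_real (cosh (real (2 * n + 1) * t))"
proof -
  have "cos (of_nat (2 * n + 1) * (\<i> * of_real t)) =
      cos (\<i> * of_real (real (2 * n + 1) * t))"
    by (simp add: algebra_simps)
  then show ?thesis
    by (simp only: cos_i_times_of_real)
qed

lemma sin_odd_half_pi_complex: "sin (of_nat (2 * n + 1) * (of_real pi / 2) :: complex) = (-1) ^ n"
proof -
  have "of_nat (2 * n + 1) * (of_real pi / 2) = complex_of_real (real (Suc (2 * n)) * pi / 2)"
    by simp
  then show ?thesis
    by (simp only: sin_of_real sin_cos_npi) simp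
qed

lemma cos_odd_half_pi_complex: "cos (of_nat (2 * n + 1) * (of_real pi / 2) :: complex) = 0"
proof -
  \<comment> \<open>The sine at this point is 1 or -1, so the Pythagorean identity forces the cosine
    to vanish.\<close>
  have "cos (of_nat (2 * n + 1) * (of_real pi / 2) :: complex) ^ 2 = 0"
    using sin_cos_squared_add[of "of_nat (2 * n + 1) * (of_real pi / 2) :: complex"]
    unfolding sin_odd_half_pi_complex by (simp flip: power_mult)
  then show ?thesis by simp
qed

lemma theta1_i_times:
  assumes "0 < q" "q < 1"
  shows "theta1 (\<i> * of_real t) q = 2 * \<i> * of_real (sinh_theta q t)"
proof -
  have "(\<lambda>n. \<i> * complex_of_real ((-1) ^ n * nome_coeff q n * sinh (real (2 * n + 1) * t))) sums
      (\<i> * of_real (sinh_theta q t))"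
    by (intro sums_mult sums_of_real sums_sinh_theta assms)
  then have "(\<lambda>n. (-1) ^ n * of_real (nome_coeff q n) * sin (of_nat (2 * n + 1) * (\<i> * of_real t)))
      sums (\<i> * of_real (sinh_theta q t))"
    unfolding sin_odd_times_i by (simp add: mult_ac)
  then show ?thesis
    by (simp add: theta1_def sums_iff)
qed

lemma theta2_minus: "theta2 (- z) q = theta2 z q"
  by (simp add: theta2_def)

text \<open>The translation acts term by term: the sine of an odd multiple of pi/2 supplies the
  alternating sign of \<open>theta1\<close>. In the companion lemma for \<open>theta1\<close> it
  cancels that sign instead.\<close>

lemma theta2_diff_half_pi: "theta2 (z - of_real pi / 2) q = theta1 z q"
  unfolding theta1_def theta2_def right_diff_distrib cos_diff
    sin_odd_half_pi_complex cos_odd_half_pi_complex by (simp add: mult_ac)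

lemma theta1_add_half_pi: "theta1 (z + of_real pi / 2) q = theta2 z q"
  unfolding theta1_def theta2_def distrib_left sin_add
    sin_odd_half_pi_complex cos_odd_half_pi_complex by (simp add: mult_ac flip: power_add mult_2)

text \<open>On the imaginary axis the cosines become cosh, so every term is positive. The limit is
  kept as a \<open>sums\<close> fact because it serves both \<open>theta2\<close> on the axis and,
  up to sign, \<open>theta1\<close> on a translate.\<close>

lemma theta2_i_times_sums:
  assumes "0 < q" "q < 1"
  obtains s where "s > 0"
    "(\<lambda>n. of_real (nome_coeff q n) * cos (of_nat (2 * n + 1) * (\<i> * of_real t)))
       sums complex_of_real s"
proof
  let ?f = "\<lambda>n. nome_coeff q n * cosh (real (2 * n + 1) * t)"
  show "suminf ?f > 0"
    using assms by (intro suminf_pos summable_nome_cosh) auto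
  show "(\<lambda>n. of_real (nome_coeff q n) * cos (of_nat (2 * n + 1) * (\<i> * of_real t)))
      sums complex_of_real (suminf ?f)"
    using sums_of_real[OF summable_sums[OF summable_nome_cosh[OF assms, of t]], where 'a = complex]
    unfolding cos_odd_times_i by simp
qed

lemma theta2_i_times_nonzero:
  assumes "0 < q" "q < 1"
  shows "theta2 (\<i> * of_real t) q \<noteq> 0"
proof -
  obtain s where "s > 0" and
    "(\<lambda>n. of_real (nome_coeff q n) * cos (of_nat (2 * n + 1) * (\<i> * of_real t)))
       sums complex_of_real s"
    using theta2_i_times_sums[OF assms] .
  then show ?thesis
    by (simp add: theta2_def sums_iff)
qed

text \<open>This excludes singularities from the two self-interaction terms; it also handles the
  first logarithm on the line X = -pi.\<close>

lemma theta1_i_times_diff_half_pi_nonzero: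
  assumes "0 < q" "q < 1"
  shows "theta1 (\<i> * of_real t - of_real pi / 2) q \<noteq> 0"
proof -
  obtain s where "s > 0" and
    s: "(\<lambda>n. of_real (nome_coeff q n) * cos (of_nat (2 * n + 1) * (\<i> * of_real t)))
       sums complex_of_real s"
    using theta2_i_times_sums[OF assms] .
  have "(\<lambda>n. (-1) ^ n * of_real (nome_coeff q n) *
      sin (of_nat (2 * n + 1) * (\<i> * of_real t - of_real pi / 2))) sums - complex_of_real s"
    using sums_minus[OF s]
    unfolding right_diff_distrib sin_diff sin_odd_half_pi_complex cos_odd_half_pi_complex
    by (simp add: mult_ac flip: power_add mult_2)
  then show ?thesis
    using \<open>s > 0\<close> by (simp add: theta1_def sums_iff)
qed

lemma theta1_i_times_eq_0_iff:
  assumes "0 < q" "q < 1/3"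
  shows "theta1 (\<i> * of_real t) q = 0 \<longleftrightarrow> (\<exists>k::int. t = of_int k * ln q)"
  using assms sinh_theta_eq_0_iff[OF assms] by (simp add: theta1_i_times)

section \<open>Singular points of the reduced Hamiltonian\<close>

lemma singular_point_iff:
  assumes "\<Gamma>\<^sub>1 \<noteq> 0" "\<Gamma>\<^sub>2 \<noteq> 0" "0 < q" "q < 1"
  shows "(X, y\<^sub>1) \<in> singular_points (reduced_hamiltonian q \<Gamma>\<^sub>1 \<Gamma>\<^sub>2 C) \<longleftrightarrow>
    X \<in> {-pi..pi} \<and>
    (theta1 (of_real X / 2 + \<i> * of_real ((y\<^sub>1 - (C - \<Gamma>\<^sub>1 * y\<^sub>1) / \<Gamma>\<^sub>2) / 2)) q = 0 \<or>
     theta2 (of_real X / 2 + \<i> * of_real ((y\<^sub>1 + (C - \<Gamma>\<^sub>1 * y\<^sub>1) / \<Gamma>\<^sub>2) / 2)) q = 0)"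
proof -
  \<comment> \<open>Separating X/2 puts the arguments on the axis or its translates once X is 0, pi
    or -pi.\<close>
  have half: "(of_real X + \<i> * of_real s) / 2 = of_real X / 2 + \<i> * complex_of_real (s / 2)" for s
    by (simp add: add_divide_distrib)
  show ?thesis
    unfolding singular_points_def reduced_hamiltonian_def mem_Collect_eq prod.case
      hamiltonian_infinite_iff[OF assms(1,2)] half
    using theta1_i_times_diff_half_pi_nonzero[OF assms(3,4)] by blast
qed

text \<open>The factor 1/2 in the theta arguments matches that in \<open>ln q\<close>, and the sign
  is absorbed by replacing k with -k.\<close>

lemma int_multiple_minus_half_pi_iff:
  "(\<exists>k::int. s / 2 = of_int k * (- pi / 2)) \<longleftrightarrow> (\<exists>k::int. s = of_int k * pi)"
proof
  assume "\<exists>k::int. s / 2 = of_int k * (- pi / 2)"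
  then obtain k :: int where "s / 2 = of_int k * (- pi / 2)" ..
  then have "s = of_int (- k) * pi" by simp
  then show "\<exists>k::int. s = of_int k * pi" ..
next
  assume "\<exists>k::int. s = of_int k * pi"
  then obtain k :: int where "s = of_int k * pi" ..
  then have "s / 2 = of_int (- k) * (- pi / 2)" by simp
  then show "\<exists>k::int. s / 2 = of_int k * (- pi / 2)" ..
qed

theorem lemma5p11:
  fixes \<Gamma>\<^sub>1 \<Gamma>\<^sub>2 C q :: real
  assumes "\<Gamma>\<^sub>1 > \<Gamma>\<^sub>2" and "\<Gamma>\<^sub>2 > 0" and "q = exp (- pi / 2)"
  shows "{y\<^sub>1. (0, y\<^sub>1) \<in> singular_points (reduced_hamiltonian q \<Gamma>\<^sub>1 \<Gamma>\<^sub>2 C)}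
           = {(pi * of_int k * \<Gamma>\<^sub>2 + C) / (\<Gamma>\<^sub>1 + \<Gamma>\<^sub>2) | k :: int. True}
      \<and> {y\<^sub>1. (pi, y\<^sub>1) \<in> singular_points (reduced_hamiltonian q \<Gamma>\<^sub>1 \<Gamma>\<^sub>2 C)}
           = {(of_int k * pi * \<Gamma>\<^sub>2 - C) / (\<Gamma>\<^sub>2 - \<Gamma>\<^sub>1) | k :: int. True}
      \<and> {y\<^sub>1. (- pi, y\<^sub>1) \<in> singular_points (reduced_hamiltonian q \<Gamma>\<^sub>1 \<Gamma>\<^sub>2 C)}
           = {(of_int k * pi * \<Gamma>\<^sub>2 - C) / (\<Gamma>\<^sub>2 - \<Gamma>\<^sub>1) | k :: int. True}"
proof -
  \<comment> \<open>With pi/2 > 3/2 the quadratic Taylor polynomial of exp exceeds 3, which gives q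
    < 1/3.\<close>
  have "3 < 1 + pi / 2 + (pi / 2)\<^sup>2 / 2"
    using pi_gt3 power_strict_mono[of "3/2" "pi / 2" 2] by (simp add: power2_eq_square)
  also have "\<dots> \<le> exp (pi / 2)"
    using pi_gt3 by (intro exp_lower_Taylor_quadratic) simp
  finally have "3 < exp (pi / 2)" .
  moreover have "q = 1 / exp (pi / 2)"
    using assms(3) by (simp add: exp_minus inverse_eq_divide)
  ultimately have q: "0 < q" "q < 1/3"
    by (simp_all add: divide_strict_left_mono)
  then have "q < 1" by simp
  have ln_q: "ln q = - pi / 2"
    using assms(3) by simp
  have \<Gamma>: "\<Gamma>\<^sub>1 \<noteq> 0" "\<Gamma>\<^sub>2 \<noteq> 0" "\<Gamma>\<^sub>1 + \<Gamma>\<^sub>2 \<noteq> 0" "\<Gamma>\<^sub>2 - \<Gamma>\<^sub>1 \<noteq> 0"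
    using assms by auto
  note singular = singular_point_iff[OF \<Gamma>(1,2) q(1) \<open>q < 1\<close>]
  have zero: "theta1 (\<i> * of_real (s / 2)) q = 0 \<longleftrightarrow> (\<exists>k::int. s = of_int k * pi)" for s
    unfolding theta1_i_times_eq_0_iff[OF q] ln_q by (rule int_multiple_minus_half_pi_iff)
  have nonzero: "theta2 (\<i> * of_real s) q \<noteq> 0" for s
    by (rule theta2_i_times_nonzero[OF q(1) \<open>q < 1\<close>])
  \<comment> \<open>On X = pi and X = -pi the roles are exchanged: \<open>theta1\<close> becomes a
    cosh series without zeros and \<open>theta2\<close> a sinh series.\<close>
  have theta1_right: "theta1 (of_real pi / 2 + \<i> * of_real s) q \<noteq> 0" for s
    using theta1_add_half_pi[of "\<i> * of_real s"] nonzero by (simp add: add.commute)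
  have theta1_left: "theta1 (- of_real pi / 2 + \<i> * of_real s) q \<noteq> 0" for s
    using theta1_i_times_diff_half_pi_nonzero[OF q(1) \<open>q < 1\<close>, of s] by (simp add: add.commute)
  have theta2_left: "theta2 (- of_real pi / 2 + \<i> * of_real (s / 2)) q = 0 \<longleftrightarrow>
      (\<exists>k::int. s = of_int k * pi)" for s
    using theta2_diff_half_pi[of "\<i> * of_real (s / 2)" q] zero[of s] by (simp add: add.commute)
  have theta2_right: "theta2 (of_real pi / 2 + \<i> * of_real (s / 2)) q = 0 \<longleftrightarrow>
      (\<exists>k::int. s = of_int k * pi)" for s
  \<comment> \<open>As \<open>theta2\<close> is even, the point pi/2 + is/2 is reflected to -pi/2 -
    is/2 on the left line, and the integer multiples of pi are symmetric about 0.\<close>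
  proof -
    have "theta2 (of_real pi / 2 + \<i> * of_real (s / 2)) q =
        theta2 (- of_real pi / 2 + \<i> * of_real (- s / 2)) q"
      using theta2_minus[of "of_real pi / 2 + \<i> * of_real (s / 2)" q] by simp
    moreover have "(\<exists>k::int. - s = of_int k * pi) \<longleftrightarrow> (\<exists>k::int. s = of_int k * pi)"
      by (metis minus_minus mult_minus_left of_int_minus)
    ultimately show ?thesis
      using theta2_left[of "- s"] by simp
  qed
  \<comment> \<open>What remains is linear in y: the difference of the heights decides on X = 0,
    their sum on the other two lines. The second equation can be solved because the strengths
    differ.\<close>
  have diff: "y - (C - \<Gamma>\<^sub>1 * y) / \<Gamma>\<^sub>2 = of_int k * pi \<longleftrightarrow>
      y = (pi * of_int k * \<Gamma>\<^sub>2 + C) / (\<Gamma>\<^sub>1 + \<Gamma>\<^sub>2)" for y and k :: int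
    using \<Gamma> by (simp add: field_simps)
  have sum: "y + (C - \<Gamma>\<^sub>1 * y) / \<Gamma>\<^sub>2 = of_int k * pi \<longleftrightarrow>
      y = (of_int k * pi * \<Gamma>\<^sub>2 - C) / (\<Gamma>\<^sub>2 - \<Gamma>\<^sub>1)" for y and k :: int
    using \<Gamma> by (simp add: field_simps)
  have "(0, y) \<in> singular_points (reduced_hamiltonian q \<Gamma>\<^sub>1 \<Gamma>\<^sub>2 C) \<longleftrightarrow>
      (\<exists>k::int. y = (pi * of_int k * \<Gamma>\<^sub>2 + C) / (\<Gamma>\<^sub>1 + \<Gamma>\<^sub>2))" for y
    unfolding singular diff[symmetric] zero[symmetric] using nonzero
    by (simp del: of_real_add of_real_diff of_real_mult of_real_divide)
  moreover have "(pi, y) \<in> singular_points (reduced_hamiltonian q \<Gamma>\<^sub>1 \<Gamma>\<^sub>2 C) \<longleftrightarrow>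
      (\<exists>k::int. y = (of_int k * pi * \<Gamma>\<^sub>2 - C) / (\<Gamma>\<^sub>2 - \<Gamma>\<^sub>1))" for y
    unfolding singular sum[symmetric] theta2_right[symmetric] using theta1_right
    by (simp del: of_real_add of_real_diff of_real_mult of_real_divide)
  moreover have "(- pi, y) \<in> singular_points (reduced_hamiltonian q \<Gamma>\<^sub>1 \<Gamma>\<^sub>2 C) \<longleftrightarrow>
      (\<exists>k::int. y = (of_int k * pi * \<Gamma>\<^sub>2 - C) / (\<Gamma>\<^sub>2 - \<Gamma>\<^sub>1))" for y
    unfolding singular sum[symmetric] theta2_left[symmetric] of_real_minus using theta1_left
    by (simp del: of_real_add of_real_diff of_real_mult of_real_divide)
  ultimately show ?thesis
    by simp
qed

end
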